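(* Let $\gamma=(1-\beta^2)^{-\frac12}$ be the Lorentz factor. Let $\xi=\xi_0\,\varepsilon(\gamma)$, where $\xi_0$ is a fixed non-zero real number and $\varepsilon$ is a continuous positive function of $\gamma$ such that $\varepsilon(\gamma)=o(1)$ and $\gamma^{-3}=o(\varepsilon(\gamma))$ as $\gamma\to\infty$. Then $$V(\xi)\sim\gamma K^{\mathrm{fs}}(3\gamma^3\xi)\quad\text{as }\gamma\to\infty,\qquad\text{if }\xi_0>0 .$$ If additionally $\gamma^{-2}=o(\varepsilon(\gamma))$, then $$\lim_{\gamma\to\infty}V(\xi)=0,\qquad\text{if }\xi_0<0 .$$
   Context: Here $\beta\in(0,1)$ is the velocity of the particle relative to the speed of light. For non-zero $\xi\in(-\pi,\pi)$, the angle $\alpha\in(-\pi,\pi)$ is determined by $\xi=\alpha-\beta|\sin\alpha|$, and the (dimensionless) potential is $$V(\xi)=\frac{1-\beta^2(1-2\sin^2\alpha)}{2\left(|\sin\alpha|-\beta\sin\alpha\cos\alpha\right)} .$$ The free space kernel is $$K^{\mathrm{fs}}(\mu)=\begin{cases}2\,\dfrac{\cosh\left[\frac53\sinh^{-1}\mu\right]-\cosh\left[\sinh^{-1}\mu\right]}{\sinh\left[2\sinh^{-1}\mu\right]}&\text{if }\mu>0,\\[1em] 0&\text{if }\mu<0,\end{cases}$$ where $\sinh^{-1}$ is the inverse hyperbolic sine. The notation $a(\gamma)\sim b(\gamma)$ means $a(\gamma)/b(\gamma)\to1$ as $\gamma\to\infty$. *)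

theory Defs
  imports Complex_Main "HOL-Library.Landau_Symbols"
begin

definition lorentz_factor :: "real \<Rightarrow> real" where
  "lorentz_factor \<beta> = (1 - \<beta>\<^sup>2) powr (-1/2)"

text \<open>The definite description is justified by the lemma \<open>ex1_retarded_angle\<close> below.\<close>

definition retarded_angle :: "real \<Rightarrow> real \<Rightarrow> real" where
  "retarded_angle \<beta> \<xi> = (THE \<alpha>. \<alpha> \<in> {-pi<..<pi} \<and> \<xi> = \<alpha> - \<beta> * \<bar>sin \<alpha>\<bar>)"

text \<open>The formula is meaningful for \<open>0 < \<beta> < 1\<close> and nonzero \<open>\<xi>\<close> in \<open>(-\<pi>, \<pi>)\<close> only.\<close>

definition potential :: "real \<Rightarrow> real \<Rightarrow> real" where
  "potential \<beta> \<xi> =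
    (let \<alpha> = retarded_angle \<beta> \<xi> in
      (1 - \<beta>\<^sup>2 * (1 - 2 * (sin \<alpha>)\<^sup>2)) / (2 * (\<bar>sin \<alpha>\<bar> - \<beta> * sin \<alpha> * cos \<alpha>)))"

text \<open>The kernel is not defined at \<open>\<mu> = 0\<close>; the value \<open>0\<close> there is a dummy.\<close>

definition K_fs :: "real \<Rightarrow> real" where
  "K_fs \<mu> =
    (if \<mu> > 0
     then 2 * ((cosh (5/3 * arsinh \<mu>) - cosh (arsinh \<mu>)) / sinh (2 * arsinh \<mu>))
     else 0)"

lemma ex1_retarded_angle:
  assumes "0 < \<beta>" "\<beta> < 1" "\<xi> \<in> {-pi<..<pi}"
  shows "\<exists>!\<alpha>. \<alpha> \<in> {-pi<..<pi} \<and> \<xi> = \<alpha> - \<beta> * \<bar>sin \<alpha>\<bar>"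
proof -
  define f where "f = (\<lambda>\<alpha>. \<alpha> - \<beta> * \<bar>sin \<alpha>\<bar>)"
  have sin_le: "\<bar>sin b - sin a\<bar> \<le> b - a" if "a < b" for a b :: real
  proof -
    have "\<exists>z>a. z < b \<and> sin b - sin a = (b - a) * cos z"
      by (rule MVT2[OF that]) (rule DERIV_sin)
    then obtain z where "sin b - sin a = (b - a) * cos z" by blast
    then show ?thesis
      using that abs_cos_le_one[of z] by (simp add: abs_mult mult_left_le)
  qed
  have mono: "f a < f b" if "a < b" for a b
  proof -
    have "\<bar>sin b\<bar> - \<bar>sin a\<bar> \<le> b - a"
      using sin_le[OF that] by linarith
    then have "\<beta> * (\<bar>sin b\<bar> - \<bar>sin a\<bar>) \<le> \<beta> * (b - a)"
      using assms by (intro mult_left_mono) auto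
    also have "\<dots> < 1 * (b - a)"
      using assms that by (intro mult_strict_right_mono) auto
    finally show ?thesis by (simp add: f_def algebra_simps)
  qed
  have "\<exists>x\<ge>-pi. x \<le> pi \<and> f x = \<xi>"
    using assms by (intro IVT') (auto simp: f_def intro!: continuous_intros)
  then obtain x where x: "-pi \<le> x" "x \<le> pi" "f x = \<xi>" by blast
  moreover have "x \<noteq> -pi" "x \<noteq> pi" using x assms by (auto simp: f_def)
  ultimately have "x \<in> {-pi<..<pi} \<and> \<xi> = f x" by auto
  moreover have "y = x" if "\<xi> = f y" for y
    using mono[of x y] mono[of y x] x that by (cases x y rule: linorder_cases) auto
  ultimately show ?thesis unfolding f_def by blast
qed

lemma ex1_velocity:
  assumes "1 < \<gamma>"
  shows "\<exists>!\<beta>. \<beta> \<in> {0<..<1} \<and> lorentz_factor \<beta> = \<gamma>"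
proof -
  have eq: "lorentz_factor b = 1 / sqrt (1 - b\<^sup>2)" if "b \<in> {0<..<1}" for b
  proof -
    have "b\<^sup>2 < 1" using that by (simp add: power_less_one_iff abs_square_less_1)
    then show ?thesis
      by (simp add: lorentz_factor_def powr_half_sqrt[symmetric] powr_minus_divide)
  qed
  define b where "b = sqrt (1 - 1 / \<gamma>\<^sup>2)"
  have g: "0 < 1 / \<gamma>\<^sup>2" "1 / \<gamma>\<^sup>2 < 1" using assms by (auto simp: one_less_power)
  then have b: "b \<in> {0<..<1}" by (auto simp: b_def real_sqrt_lt_1_iff)
  have "lorentz_factor b = \<gamma>"
    using eq[OF b] g assms by (simp add: b_def real_sqrt_divide)
  moreover have "c = b" if c: "c \<in> {0<..<1}" "lorentz_factor c = \<gamma>" for c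
  proof -
    have "1 / sqrt (1 - c\<^sup>2) = \<gamma>" using eq[OF c(1)] c(2) by simp
    then have "sqrt (1 - c\<^sup>2) = 1 / \<gamma>" using assms by (auto simp: field_simps)
    moreover have "c\<^sup>2 < 1" using c by (simp add: abs_square_less_1)
    ultimately have "1 - c\<^sup>2 = (1 / \<gamma>)\<^sup>2" by (metis diff_ge_0_iff_ge less_imp_le real_sqrt_pow2)
    then have "c\<^sup>2 = 1 - 1 / \<gamma>\<^sup>2" by (simp add: power_divide)
    then show ?thesis using c unfolding b_def by (metis greaterThanLessThan_iff less_imp_le real_sqrt_unique)
  qed
  ultimately show ?thesis using b by blast
qed

end

theory Submission imports Defs "HOL-Real_Asymp.Real_Asymp"
begin

text \<open>
  Let \<open>\<alpha>\<close> be the retarded angle. For \<open>\<xi> > 0\<close> we have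
  \<open>\<xi> = (1 - \<beta>) \<alpha> + \<beta> (\<alpha> - sin \<alpha>)\<close> with \<open>1 - \<beta> \<le> \<gamma>\<^sup>-\<^sup>2\<close>, so \<open>\<gamma>\<^sup>3 \<xi> \<rightarrow> \<infinity>\<close> forces
  \<open>\<gamma> \<alpha> \<rightarrow> \<infinity>\<close>. Then \<open>1 - \<beta>\<close> is negligible against \<open>\<alpha>\<^sup>2\<close>, which gives \<open>\<xi> \<sim> \<alpha>\<^sup>3 / 6\<close> and
  \<open>V \<sim> 2 / \<alpha>\<close>, that is \<open>V \<sim> (4 / (3 \<xi>))\<^sup>1\<^sup>/\<^sup>3\<close>. This agrees with \<open>\<gamma> K(3 \<gamma>\<^sup>3 \<xi>)\<close>, because
  \<open>K(\<mu>) \<sim> (4 / \<mu>)\<^sup>1\<^sup>/\<^sup>3\<close> at infinity. For \<open>\<xi> < 0\<close> the angle lies between \<open>\<xi>\<close> and \<open>\<xi> / 2\<close>,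
  and \<open>V\<close> is of order \<open>(1 - \<beta>\<^sup>2) / \<bar>\<alpha>\<bar> + \<bar>\<alpha>\<bar>\<close>.
\<close>

section \<open>Decay of the free space kernel at infinity\<close>

lemma K_fs_asymptotics: "((\<lambda>\<mu>. K_fs \<mu> * \<mu> powr (1/3)) \<longlongrightarrow> 4 powr (1/3)) at_top"
proof -
  have "((\<lambda>\<mu>::real. 2 * ((cosh (5/3 * arsinh \<mu>) - cosh (arsinh \<mu>)) / sinh (2 * arsinh \<mu>)) * \<mu> powr (1/3))
      \<longlongrightarrow> 4 powr (1/3)) at_top"
  proof -
    have "(4::real) powr (1/3) = 2 powr (2/3)"
      using powr_powr[of "2::real" 2 "1/3"] by simp
    \<comment> \<open>The leading exponentials give 2 (2\<mu>)^(5/3) / (2\<mu>)^2. The left side is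
      its coefficient of \<mu>^(-1/3), with the powers of 2 written through \<open>exp\<close> and
      \<open>ln\<close>.\<close>
    moreover have "2 * exp (5 * ln 2 / 3) / exp (2 * ln 2) = (2::real) powr (2/3)"
    proof -
      have "2 * exp (5 * ln 2 / 3) / exp (2 * ln 2) = exp (ln 2 + 5 * ln 2 / 3 - 2 * ln (2::real))"
        by (simp only: exp_diff exp_add) simp
      also have "ln 2 + 5 * ln 2 / 3 - 2 * ln 2 = 2 / 3 * ln (2::real)"
        by simp
      finally show ?thesis by (simp only: powr_def) simp
    qed
    ultimately show ?thesis
      unfolding cosh_def sinh_def arsinh_real_def real_scaleR_def by real_asymp
  qed
  then show ?thesis
    by (rule Lim_transform_eventually)
      (use eventually_gt_at_top[of "0::real"] in eventually_elim, simp add: K_fs_def)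
qed

section \<open>Sign and size of the retarded angle\<close>

lemma retarded_angle:
  assumes "0 < \<beta>" "\<beta> < 1" "\<xi> \<in> {-pi<..<pi}"
  shows "retarded_angle \<beta> \<xi> \<in> {-pi<..<pi}"
    and "\<xi> = retarded_angle \<beta> \<xi> - \<beta> * \<bar>sin (retarded_angle \<beta> \<xi>)\<bar>"
  using theI'[OF ex1_retarded_angle[OF assms]]
  unfolding retarded_angle_def by (fact conjunct1, fact conjunct2)

lemma retarded_angle_pos:
  assumes "0 < \<beta>" "\<beta> < 1" "\<xi> \<in> {0<..<pi}"
  shows "retarded_angle \<beta> \<xi> \<in> {0<..<pi}"
    and "\<xi> = retarded_angle \<beta> \<xi> - \<beta> * sin (retarded_angle \<beta> \<xi>)"
proof -
  define a where "a = retarded_angle \<beta> \<xi>"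
  have a: "a \<in> {-pi<..<pi}" "\<xi> = a - \<beta> * \<bar>sin a\<bar>"
    using retarded_angle[of \<beta> \<xi>] assms by (auto simp: a_def)
  have "0 \<le> \<beta> * \<bar>sin a\<bar>" using assms by simp
  with a(2) assms have "0 < a" unfolding greaterThanLessThan_iff by linarith
  with a(1) have pos: "a \<in> {0<..<pi}" by simp
  then show "retarded_angle \<beta> \<xi> \<in> {0<..<pi}" by (simp add: a_def)
  have "\<bar>sin a\<bar> = sin a" using pos sin_gt_zero[of a] by simp
  with a(2) show "\<xi> = retarded_angle \<beta> \<xi> - \<beta> * sin (retarded_angle \<beta> \<xi>)"
    by (simp only: a_def)
qed

text \<open>A nonnegative angle would make \<alpha> - \<beta> |sin \<alpha>| nonnegative, so
  \<alpha> < 0. Then 0 \<le> \<beta> |sin \<alpha>| \<le> -\<alpha> yields 2\<alpha> \<le> \<xi>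
  \<le> \<alpha>: on this side the angle is comparable to \<xi>, uniformly in \<beta>.\<close>

lemma retarded_angle_neg_bounds:
  assumes "0 < \<beta>" "\<beta> < 1" "\<xi> \<in> {-pi<..<0}"
  shows "retarded_angle \<beta> \<xi> \<in> {\<xi>..\<xi>/2}"
proof -
  define a where "a = retarded_angle \<beta> \<xi>"
  have a: "\<xi> = a - \<beta> * \<bar>sin a\<bar>"
    using retarded_angle[of \<beta> \<xi>] assms by (auto simp: a_def)
  have "\<beta> * \<bar>sin a\<bar> \<le> \<beta> * \<bar>a\<bar>"
    using assms abs_sin_x_le_abs_x by (intro mult_left_mono) auto
  moreover have "\<beta> * \<bar>a\<bar> \<le> 1 * \<bar>a\<bar>"
    using assms by (intro mult_right_mono) auto
  moreover have "a < 0"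
  proof (rule ccontr)
    assume "\<not> a < 0"
    with calculation have "\<beta> * \<bar>sin a\<bar> \<le> a" by linarith
    with a assms show False unfolding greaterThanLessThan_iff by linarith
  qed
  moreover have "0 \<le> \<beta> * \<bar>sin a\<bar>" using assms by simp
  ultimately have "a \<le> \<xi> / 2" "\<xi> \<le> a" using a by linarith+
  then show ?thesis by (simp add: a_def)
qed

lemma one_minus_sq_of_lorentz_factor:
  assumes "0 < \<beta>" "\<beta> < 1"
  shows "1 - \<beta>\<^sup>2 = 1 / (lorentz_factor \<beta>)\<^sup>2"
proof -
  have "\<beta>\<^sup>2 < 1" using assms by (simp add: abs_square_less_1)
  then show ?thesis
    by (simp add: lorentz_factor_def powr_half_sqrt powr_minus_divide power_divide)
qed

text \<open>The angle \<open>a\<close> satisfies a - sin a \<le> a - b sin a = x, and u - sin u is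
  nondecreasing and positive for u > 0. A small \<open>x\<close> therefore forces a small
  \<open>a\<close>, uniformly in \<open>b\<close>.\<close>

lemma retarded_angle_tendsto_0:
  fixes b x :: "'a \<Rightarrow> real"
  assumes b: "eventually (\<lambda>t. 0 < b t \<and> b t < 1) F"
    and x: "(x \<longlongrightarrow> 0) F" "eventually (\<lambda>t. 0 < x t) F"
  shows "((\<lambda>t. retarded_angle (b t) (x t)) \<longlongrightarrow> 0) F"
proof (rule order_tendstoI)
  have bx: "eventually (\<lambda>t. 0 < b t \<and> b t < 1 \<and> x t \<in> {0<..<pi}) F"
    using b x(2) order_tendstoD(2)[OF x(1) pi_gt_zero] by eventually_elim auto
  show "eventually (\<lambda>t. e < retarded_angle (b t) (x t)) F" if "e < 0" for e
    using bx by eventually_elim (use retarded_angle_pos(1) that in force)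
  show "eventually (\<lambda>t. retarded_angle (b t) (x t) < e) F" if "0 < e" for e
  proof -
    \<comment> \<open>Strictness comes from sin u = 2 sin(u/2) cos(u/2) with cos(u/2) < 1. The bound
      2 keeps u/2 below \<pi>, so that sin(u/2) > 0; beyond it, sin u \<le> 1 is enough.\<close>
    have sin_less: "sin u < u" if "0 < u" for u :: real
    proof (cases "u \<le> 2")
      case True
      then have u: "u / 2 \<le> pi" "0 < sin (u / 2)"
        using that pi_ge_two by (auto intro!: sin_gt_zero)
      then have "cos (u / 2) < 1"
        using that cos_monotone_0_pi[of 0 "u / 2"] by simp
      then have "2 * sin (u / 2) * cos (u / 2) < 2 * sin (u / 2)"
        using u by simp
      then show ?thesis
        using sin_double[of "u / 2"] sin_x_le_x[of "u / 2"] that by simp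
    next
      case False
      then show ?thesis using sin_le_one[of u] by linarith
    qed
    have "0 < e - sin e" using sin_less[OF that] by simp
    from bx order_tendstoD(2)[OF x(1) this] show ?thesis
    proof eventually_elim
      case (elim t)
      define a where "a = retarded_angle (b t) (x t)"
      have a: "a \<in> {0<..<pi}" "x t = a - b t * sin a"
        using retarded_angle_pos[of "b t" "x t"] elim by (auto simp: a_def)
      have "b t * sin a \<le> 1 * sin a"
        using elim a by (intro mult_right_mono sin_ge_zero) auto
      then have less: "a - sin a < e - sin e" using a elim by simp
      have "\<not> e \<le> a"
      proof
        \<comment> \<open>The sum-to-product formula shows that sine is 1-Lipschitz, hence e - sin e
          \<le> a - sin a, against \<open>less\<close>.\<close>
        assume "e \<le> a"
        have "sin a - sin e = 2 * sin ((a - e) / 2) * cos ((a + e) / 2)"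
          by (rule sin_diff_sin)
        also have "\<dots> \<le> \<bar>2 * sin ((a - e) / 2)\<bar> * \<bar>cos ((a + e) / 2)\<bar>"
          by (simp only: abs_mult[symmetric] abs_ge_self)
        also have "\<dots> \<le> \<bar>2 * sin ((a - e) / 2)\<bar> * 1"
          by (intro mult_left_mono) auto
        also have "\<dots> \<le> a - e"
          using abs_sin_x_le_abs_x[of "(a - e) / 2"] \<open>e \<le> a\<close> by simp
        finally show False using less by simp
      qed
      then show ?case by (simp add: a_def)
    qed
  qed
qed

section \<open>The potential for positive \<xi>, after rescaling by powers of the angle\<close>

lemma potential_asymptotics_pos:
  fixes b g x :: "'a \<Rightarrow> real"
  assumes b: "eventually (\<lambda>t. 0 < b t \<and> b t < 1 \<and> 1 - (b t)\<^sup>2 = 1 / (g t)\<^sup>2) F" "(b \<longlongrightarrow> 1) F"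
    and g: "eventually (\<lambda>t. 0 < g t) F"
    and x: "(x \<longlongrightarrow> 0) F" "eventually (\<lambda>t. 0 < x t) F"
    and gx: "filterlim (\<lambda>t. g t ^ 3 * x t) at_top F"
  shows "((\<lambda>t. potential (b t) (x t) * x t powr (1/3)) \<longlongrightarrow> (4/3) powr (1/3)) F"
proof -
  define a where "a = (\<lambda>t. retarded_angle (b t) (x t))"
  have a0: "(a \<longlongrightarrow> 0) F" unfolding a_def
    by (rule retarded_angle_tendsto_0[OF _ x]) (use b(1) in eventually_elim, simp)
  have a: "eventually (\<lambda>t. a t \<in> {0<..<pi} \<and> x t = a t - b t * sin (a t)) F"
    using b(1) x(2) order_tendstoD(2)[OF x(1) pi_gt_zero]
    by eventually_elim (use retarded_angle_pos in \<open>auto simp: a_def\<close>)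
  have a_right: "filterlim a (at_right 0) F"
    using a0 by (intro filterlim_at_withinI) (auto intro: eventually_mono[OF a])
  \<comment> \<open>With y = g a, the estimate below reads g^3 x \<le> y + y^3. If y \<le> M, the
    right side is at most |M| + |M|^3, which g^3 x eventually exceeds.\<close>
  have ga: "filterlim (\<lambda>t. g t * a t) at_top F"
    unfolding filterlim_at_top_dense
  proof
    fix M :: real
    \<comment> \<open>Constant 1 instead of the sharp 1/6: only the order of growth matters
      here.\<close>
    have "eventually (\<lambda>u::real. u - sin u \<le> u ^ 3) (at_right 0)"
      by real_asymp
    then have "eventually (\<lambda>t. a t - sin (a t) \<le> a t ^ 3) F"
      by (rule eventually_compose_filterlim[OF _ a_right])
    moreover have "eventually (\<lambda>t. \<bar>M\<bar> + \<bar>M\<bar> ^ 3 < g t ^ 3 * x t) F"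
      using gx unfolding filterlim_at_top_dense by blast
    ultimately show "eventually (\<lambda>t. M < g t * a t) F"
      using a b(1) g
    proof eventually_elim
      case (elim t)
      have "(1 - b t) * 1 \<le> (1 - b t) * (1 + b t)"
        using elim by (intro mult_left_mono) auto
      also have "\<dots> = 1 / (g t)\<^sup>2"
        using elim by (simp add: algebra_simps power2_eq_square)
      finally have "(1 - b t) * a t \<le> 1 / (g t)\<^sup>2 * a t"
        using elim by (intro mult_right_mono) auto
      moreover have "b t * (a t - sin (a t)) \<le> 1 * a t ^ 3"
        using elim sin_x_le_x[of "a t"] by (intro mult_mono) auto
      ultimately have "x t \<le> 1 / (g t)\<^sup>2 * a t + a t ^ 3"
        using elim by (simp add: algebra_simps)
      then have "g t ^ 3 * x t \<le> g t ^ 3 * (1 / (g t)\<^sup>2 * a t + a t ^ 3)"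
        using elim by (intro mult_left_mono) auto
      also have "\<dots> = g t * a t + (g t * a t) ^ 3"
        using elim by (simp add: field_simps power2_eq_square power3_eq_cube)
      finally have le: "g t ^ 3 * x t \<le> g t * a t + (g t * a t) ^ 3" .
      show ?case
      proof (rule ccontr)
        assume "\<not> M < g t * a t"
        then have "g t * a t \<le> \<bar>M\<bar>" by simp
        moreover from this have "(g t * a t) ^ 3 \<le> \<bar>M\<bar> ^ 3"
          using elim by (intro power_mono) auto
        ultimately show False using le elim by linarith
      qed
    qed
  qed
  \<comment> \<open>This quotient is (g a)^(-2). Dividing it by 1 + b, which tends to 2, gives
    \<open>d1\<close>.\<close>
  have d2: "((\<lambda>t. (1 - (b t)\<^sup>2) / (a t)\<^sup>2) \<longlongrightarrow> 0) F"
  proof -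
    have lim: "((\<lambda>t. inverse (g t * a t) ^ 2) \<longlongrightarrow> 0 ^ 2) F"
      by (intro tendsto_power filterlim_compose[OF tendsto_inverse_0_at_top ga] tendsto_inverse_0_at_top ga)
    have eq: "eventually (\<lambda>t. inverse (g t * a t) ^ 2 = (1 - (b t)\<^sup>2) / (a t)\<^sup>2) F"
      using b(1)
    proof eventually_elim
      case (elim t)
      then have "1 - (b t)\<^sup>2 = 1 / (g t)\<^sup>2" by blast
      then show ?case
        by (simp only:) (simp add: power_mult_distrib power_inverse divide_inverse)
    qed
    from Lim_transform_eventually[OF lim eq] show ?thesis by simp
  qed
  have d1: "((\<lambda>t. (1 - b t) / (a t)\<^sup>2) \<longlongrightarrow> 0) F"
  proof -
    have lim: "((\<lambda>t. (1 - (b t)\<^sup>2) / (a t)\<^sup>2 / (1 + b t)) \<longlongrightarrow> 0 / (1 + 1)) F"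
      by (rule tendsto_divide[OF d2 tendsto_add[OF tendsto_const b(2)]]) simp
    have eq: "eventually (\<lambda>t. (1 - (b t)\<^sup>2) / (a t)\<^sup>2 / (1 + b t) = (1 - b t) / (a t)\<^sup>2) F"
      using b(1)
    proof eventually_elim
      case (elim t)
      have "1 - (b t)\<^sup>2 = (1 - b t) * (1 + b t)"
        by (simp add: algebra_simps power2_eq_square)
      moreover have "1 + b t \<noteq> 0" using elim by auto
      ultimately show ?case by simp
    qed
    from Lim_transform_eventually[OF lim eq] show ?thesis by simp
  qed
  have s1: "((\<lambda>t. sin (a t) / a t) \<longlongrightarrow> 1) F"
    by (rule filterlim_compose[OF _ a_right]) real_asymp
  have s3: "((\<lambda>t. (a t - sin (a t)) / a t ^ 3) \<longlongrightarrow> 1/6) F"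
    by (rule filterlim_compose[OF _ a_right]) real_asymp
  have c2: "((\<lambda>t. (1 - cos (a t)) / (a t)\<^sup>2) \<longlongrightarrow> 1/2) F"
    by (rule filterlim_compose[OF _ a_right]) real_asymp
  \<comment> \<open>The base of the power is x / a^3, split as (1 - b)/a^2 + b (a - sin a)/a^3; only
    the second summand survives, with limit 1/6.\<close>
  have lim: "((\<lambda>t. ((1 - b t) / (a t)\<^sup>2 + b t * ((a t - sin (a t)) / a t ^ 3)) powr (1/3))
      \<longlongrightarrow> (0 + 1 * (1/6)) powr (1/3)) F"
    by (rule tendsto_powr[OF tendsto_add[OF d1 tendsto_mult[OF b(2) s3]] tendsto_const]) simp
  have eq: "eventually (\<lambda>t. ((1 - b t) / (a t)\<^sup>2 + b t * ((a t - sin (a t)) / a t ^ 3)) powr (1/3)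
      = x t powr (1/3) / a t) F"
    using a x(2)
  proof eventually_elim
    case (elim t)
    have a: "0 < a t" and x: "x t = a t - b t * sin (a t)" using elim by auto
    have "(1 - b t) / (a t)\<^sup>2 + b t * ((a t - sin (a t)) / a t ^ 3) = x t / a t ^ 3"
      unfolding x using a by (simp add: field_simps power2_eq_square power3_eq_cube)
    moreover have "(a t ^ 3) powr (1/3) = a t"
      using elim by (simp add: powr_powr flip: powr_numeral)
    ultimately show ?case using elim by (simp add: powr_divide)
  qed
  from Lim_transform_eventually[OF lim eq]
  have x_lim: "((\<lambda>t. x t powr (1/3) / a t) \<longlongrightarrow> (1/6) powr (1/3)) F"
    by simp

  \<comment> \<open>The first factor is a V: the numerator of V is divided by a^2, and the
    denominator 2 sin a (1 - b cos a) by a^3, using 1 - b cos a = (1 - b) + b (1 - cos a). Hence a V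
    tends to 2, and \<open>x_lim\<close> converts \<open>a\<close> into x^(1/3).\<close>
  have lim: "((\<lambda>t. ((1 - (b t)\<^sup>2) / (a t)\<^sup>2 + 2 * (b t)\<^sup>2 * (sin (a t) / a t)\<^sup>2) /
        (2 * (sin (a t) / a t) * ((1 - b t) / (a t)\<^sup>2 + b t * ((1 - cos (a t)) / (a t)\<^sup>2)))
        * (x t powr (1/3) / a t))
      \<longlongrightarrow> (0 + 2 * 1\<^sup>2 * 1\<^sup>2) / (2 * 1 * (0 + 1 * (1/2))) * (1/6) powr (1/3)) F"
    by (rule tendsto_mult[OF tendsto_divide[OF
        tendsto_add[OF d2 tendsto_mult[OF tendsto_mult[OF tendsto_const tendsto_power[OF b(2)]] tendsto_power[OF s1]]]
        tendsto_mult[OF tendsto_mult[OF tendsto_const s1] tendsto_add[OF d1 tendsto_mult[OF b(2) c2]]]] x_lim]) simp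
  have lim_eq: "(0 + 2 * 1\<^sup>2 * 1\<^sup>2) / (2 * 1 * (0 + 1 * (1/2))) * (1/6) powr (1/3) = (4/3 :: real) powr (1/3)"
  proof -
    have "(2::real) = 8 powr (1/3)" using powr_powr[of "2::real" 3 "1/3"] by simp
    then have "2 * (1/6) powr (1/3) = (8 * (1/6) :: real) powr (1/3)"
      by (simp only: powr_mult)
    then show ?thesis by simp
  qed
  have eq: "eventually (\<lambda>t. ((1 - (b t)\<^sup>2) / (a t)\<^sup>2 + 2 * (b t)\<^sup>2 * (sin (a t) / a t)\<^sup>2) /
        (2 * (sin (a t) / a t) * ((1 - b t) / (a t)\<^sup>2 + b t * ((1 - cos (a t)) / (a t)\<^sup>2)))
        * (x t powr (1/3) / a t) = potential (b t) (x t) * x t powr (1/3)) F"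
    using a
  proof eventually_elim
    case (elim t)
    define A where "A = a t"
    define B where "B = b t"
    have A: "0 < A" "0 < sin A" using elim sin_gt_zero by (auto simp: A_def)
    have "((1 - B\<^sup>2) / A\<^sup>2 + 2 * B\<^sup>2 * (sin A / A)\<^sup>2) = (1 - B\<^sup>2 * (1 - 2 * (sin A)\<^sup>2)) / A\<^sup>2"
      using A by (simp add: field_simps)
    moreover have "2 * (sin A / A) * ((1 - B) / A\<^sup>2 + B * ((1 - cos A) / A\<^sup>2))
        = 2 * (\<bar>sin A\<bar> - B * sin A * cos A) / A\<^sup>2 / A"
      using A by (simp add: field_simps)
    moreover have "potential B (x t) = (1 - B\<^sup>2 * (1 - 2 * (sin A)\<^sup>2)) / (2 * (\<bar>sin A\<bar> - B * sin A * cos A))"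
      by (simp add: potential_def Let_def A_def B_def a_def)
    ultimately show ?case
      using A unfolding A_def[symmetric] B_def[symmetric] by simp
  qed
  from Lim_transform_eventually[OF lim eq] show ?thesis unfolding lim_eq .
qed

section \<open>The potential for negative \<xi>\<close>

lemma potential_tendsto_0_neg:
  fixes b x :: "'a \<Rightarrow> real"
  assumes b: "eventually (\<lambda>t. 0 < b t \<and> b t < 1) F" "(b \<longlongrightarrow> 1) F"
    and x: "(x \<longlongrightarrow> 0) F" "eventually (\<lambda>t. x t < 0) F"
    and bx: "((\<lambda>t. (1 - (b t)\<^sup>2) / x t) \<longlongrightarrow> 0) F"
  shows "((\<lambda>t. potential (b t) (x t)) \<longlongrightarrow> 0) F"
proof -
  define s where "s = (\<lambda>t. - retarded_angle (b t) (x t))"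
  have s: "eventually (\<lambda>t. 0 < s t \<and> - x t / 2 \<le> s t \<and> s t \<le> - x t) F"
    using b(1) x(2) order_tendstoD(1)[OF x(1), of "-pi", simplified]
  proof eventually_elim
    case (elim t)
    then show ?case using retarded_angle_neg_bounds[of "b t" "x t"] by (auto simp: s_def)
  qed
  have s0: "(s \<longlongrightarrow> 0) F"
  proof (rule tendsto_sandwich[of "\<lambda>_. 0"])
    show "((\<lambda>t. - x t) \<longlongrightarrow> 0) F" using tendsto_minus[OF x(1)] by simp
  qed (auto intro: eventually_mono[OF s])
  have s_right: "filterlim s (at_right 0) F"
    using s0 by (intro filterlim_at_withinI) (auto intro: eventually_mono[OF s])
  have s1: "((\<lambda>t. sin (s t) / s t) \<longlongrightarrow> 1) F"
    by (rule filterlim_compose[OF _ s_right]) real_asymp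
  \<comment> \<open>The lower bound s \<ge> -x/2 transfers \<open>bx\<close> from \<open>x\<close>
    to \<open>s\<close> at the cost of a factor -2.\<close>
  have d: "((\<lambda>t. (1 - (b t)\<^sup>2) / s t) \<longlongrightarrow> 0) F"
  proof (rule tendsto_sandwich[of "\<lambda>_. 0"])
    show "((\<lambda>t. - 2 * ((1 - (b t)\<^sup>2) / x t)) \<longlongrightarrow> 0) F" using tendsto_mult[OF tendsto_const[of "-2"] bx] by simp
    have neg_half: "c / (- y / 2) = - 2 * (c / y)" for c y :: real
      by simp
    have sq: "0 \<le> 1 - (b t)\<^sup>2" if "0 < b t \<and> b t < 1" for t
      using that by (simp add: abs_square_le_1)
    show "eventually (\<lambda>t. 0 \<le> (1 - (b t)\<^sup>2) / s t) F"
      using s b(1) by eventually_elim (use sq in auto)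
    show "eventually (\<lambda>t. (1 - (b t)\<^sup>2) / s t \<le> - 2 * ((1 - (b t)\<^sup>2) / x t)) F"
      using s b(1) x(2)
    proof eventually_elim
      case (elim t)
      have "(1 - (b t)\<^sup>2) / s t \<le> (1 - (b t)\<^sup>2) / (- x t / 2)"
        using elim sq[of t] by (intro divide_left_mono mult_pos_pos) auto
      also have "\<dots> = - 2 * ((1 - (b t)\<^sup>2) / x t)"
        by (rule neg_half)
      finally show ?case .
    qed
  qed auto
  \<comment> \<open>Numerator and denominator of V are both divided by \<open>s\<close>. With
    \<alpha> = -s the denominator is 2 sin s (1 + b cos s): the two terms add, so it is of order
    \<open>s\<close> rather than s^3, and after division it tends to 4.\<close>
  have lim: "((\<lambda>t. ((1 - (b t)\<^sup>2) / s t + 2 * (b t)\<^sup>2 * (sin (s t) / s t)\<^sup>2 * s t) /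
        (2 * (sin (s t) / s t) * (1 + b t * cos (s t))))
      \<longlongrightarrow> (0 + 2 * 1\<^sup>2 * 1\<^sup>2 * 0) / (2 * 1 * (1 + 1 * cos 0))) F"
    by (rule tendsto_divide[OF
        tendsto_add[OF d tendsto_mult[OF tendsto_mult[OF
          tendsto_mult[OF tendsto_const tendsto_power[OF b(2)]] tendsto_power[OF s1]] s0]]
        tendsto_mult[OF tendsto_mult[OF tendsto_const s1]
          tendsto_add[OF tendsto_const tendsto_mult[OF b(2) isCont_tendsto_compose[OF isCont_cos s0]]]]]) simp
  have eq: "eventually (\<lambda>t. ((1 - (b t)\<^sup>2) / s t + 2 * (b t)\<^sup>2 * (sin (s t) / s t)\<^sup>2 * s t) /
        (2 * (sin (s t) / s t) * (1 + b t * cos (s t))) = potential (b t) (x t)) F"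
    using s order_tendstoD(2)[OF s0 pi_gt_zero]
  proof eventually_elim
    case (elim t)
    define S where "S = s t"
    define B where "B = b t"
    have S: "0 < S" "0 < sin S" using elim sin_gt_zero unfolding S_def by blast+
    have "retarded_angle B (x t) = - S" by (simp add: S_def B_def s_def)
    then have V: "potential B (x t) = (1 - B\<^sup>2 * (1 - 2 * (sin S)\<^sup>2)) / (2 * (sin S + B * sin S * cos S))"
      using S by (simp add: potential_def)
    have num: "(1 - B\<^sup>2) / S + 2 * B\<^sup>2 * (sin S / S)\<^sup>2 * S = (1 - B\<^sup>2 * (1 - 2 * (sin S)\<^sup>2)) / S"
      using S by (simp add: field_simps power2_eq_square)
    have den: "2 * (sin S / S) * (1 + B * cos S) = 2 * (sin S + B * sin S * cos S) / S"
      using S by (simp add: field_simps)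
    show ?case
      unfolding S_def[symmetric] B_def[symmetric] V num den using S(1) by simp
  qed
  from Lim_transform_eventually[OF lim eq] show ?thesis by simp
qed

section \<open>Specialization to \<xi> proportional to \<epsilon>(\<gamma>) and comparison with the
  kernel\<close>

theorem proposition4p4:
  fixes \<beta> \<epsilon> :: "real \<Rightarrow> real" and \<xi>\<^sub>0 :: real
  assumes \<beta>: "\<And>\<gamma>. \<gamma> > 1 \<Longrightarrow> \<beta> \<gamma> \<in> {0<..<1} \<and> \<gamma> = lorentz_factor (\<beta> \<gamma>)"
    and \<xi>\<^sub>0: "\<xi>\<^sub>0 \<noteq> 0"
    and \<epsilon>_cont: "continuous_on {1<..} \<epsilon>"
    and \<epsilon>_pos: "\<And>\<gamma>. \<gamma> > 1 \<Longrightarrow> \<epsilon> \<gamma> > 0"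
    and \<epsilon>_small: "\<epsilon> \<in> o[at_top](\<lambda>\<gamma>. 1)"
    and \<epsilon>_large: "(\<lambda>\<gamma>. \<gamma> powi (-3)) \<in> o[at_top](\<epsilon>)"
  shows "(\<xi>\<^sub>0 > 0 \<longrightarrow>
            (\<lambda>\<gamma>. potential (\<beta> \<gamma>) (\<xi>\<^sub>0 * \<epsilon> \<gamma>))
              \<sim>[at_top] (\<lambda>\<gamma>. \<gamma> * K_fs (3 * \<gamma> ^ 3 * (\<xi>\<^sub>0 * \<epsilon> \<gamma>))))
       \<and> (\<xi>\<^sub>0 < 0 \<longrightarrow> (\<lambda>\<gamma>. \<gamma> powi (-2)) \<in> o[at_top](\<epsilon>) \<longrightarrow>
            ((\<lambda>\<gamma>. potential (\<beta> \<gamma>) (\<xi>\<^sub>0 * \<epsilon> \<gamma>)) \<longlongrightarrow> 0) at_top)"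
proof -
  have ev1: "eventually (\<lambda>\<gamma>::real. 1 < \<gamma>) at_top"
    by (rule eventually_gt_at_top)
  have b1: "0 < \<beta> \<gamma> \<and> \<beta> \<gamma> < 1 \<and> 1 - (\<beta> \<gamma>)\<^sup>2 = 1 / \<gamma>\<^sup>2" if "1 < \<gamma>" for \<gamma>
    using \<beta>[OF that] one_minus_sq_of_lorentz_factor[of "\<beta> \<gamma>"] by auto
  have b: "eventually (\<lambda>\<gamma>. 0 < \<beta> \<gamma> \<and> \<beta> \<gamma> < 1 \<and> 1 - (\<beta> \<gamma>)\<^sup>2 = 1 / \<gamma>\<^sup>2) at_top"
    by (rule eventually_mono[OF ev1 b1])
  have b_lim: "(\<beta> \<longlongrightarrow> 1) at_top"
  proof (rule Lim_transform_eventually)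
    show "((\<lambda>\<gamma>::real. sqrt (1 - 1 / \<gamma>\<^sup>2)) \<longlongrightarrow> 1) at_top" by real_asymp
    show "eventually (\<lambda>\<gamma>. sqrt (1 - 1 / \<gamma>\<^sup>2) = \<beta> \<gamma>) at_top"
      using b
    proof eventually_elim
      case (elim \<gamma>)
      then have "1 - 1 / \<gamma>\<^sup>2 = (\<beta> \<gamma>)\<^sup>2" by linarith
      with elim show ?case by simp
    qed
  qed
  have "(\<epsilon> \<longlongrightarrow> 0) at_top" using smalloD_tendsto[OF \<epsilon>_small] by simp
  from tendsto_mult[OF tendsto_const this]
  have x_lim: "((\<lambda>\<gamma>. \<xi>\<^sub>0 * \<epsilon> \<gamma>) \<longlongrightarrow> 0) at_top" by simp
  show ?thesis
  proof (intro conjI impI)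
    assume pos: "0 < \<xi>\<^sub>0"
    have x_pos: "eventually (\<lambda>\<gamma>. 0 < \<xi>\<^sub>0 * \<epsilon> \<gamma>) at_top"
      using ev1 by eventually_elim (use pos \<epsilon>_pos in simp)
    \<comment> \<open>Since the quotient is positive and tends to 0, its reciprocal \<gamma>^3
      \<epsilon> tends to plus infinity.\<close>
    have "((\<lambda>\<gamma>. \<gamma> powi (-3) / \<epsilon> \<gamma>) \<longlongrightarrow> 0) at_top"
      by (rule smalloD_tendsto[OF \<epsilon>_large])
    moreover have "eventually (\<lambda>\<gamma>. 0 < \<gamma> powi (-3) / \<epsilon> \<gamma>) at_top"
      using ev1 by eventually_elim (use \<epsilon>_pos in auto)
    ultimately have "filterlim (\<lambda>\<gamma>. inverse (\<gamma> powi (-3) / \<epsilon> \<gamma>)) at_top at_top"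
      by (rule filterlim_inverse_at_top)
    then have "filterlim (\<lambda>\<gamma>. \<xi>\<^sub>0 * inverse (\<gamma> powi (-3) / \<epsilon> \<gamma>)) at_top at_top"
      by (rule filterlim_tendsto_pos_mult_at_top[OF tendsto_const pos])
    also have "(\<lambda>\<gamma>. \<xi>\<^sub>0 * inverse (\<gamma> powi (-3) / \<epsilon> \<gamma>)) = (\<lambda>\<gamma>. \<gamma> ^ 3 * (\<xi>\<^sub>0 * \<epsilon> \<gamma>))"
      by (simp add: power_int_minus fun_eq_iff field_simps)
    finally have gx: "filterlim (\<lambda>\<gamma>. \<gamma> ^ 3 * (\<xi>\<^sub>0 * \<epsilon> \<gamma>)) at_top at_top" .
    then have gx3: "filterlim (\<lambda>\<gamma>. 3 * (\<gamma> ^ 3 * (\<xi>\<^sub>0 * \<epsilon> \<gamma>))) at_top at_top"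
      by (intro filterlim_tendsto_pos_mult_at_top[OF tendsto_const]) auto
    have V: "((\<lambda>\<gamma>. potential (\<beta> \<gamma>) (\<xi>\<^sub>0 * \<epsilon> \<gamma>) * (\<xi>\<^sub>0 * \<epsilon> \<gamma>) powr (1/3)) \<longlongrightarrow> (4/3) powr (1/3)) at_top"
      by (rule potential_asymptotics_pos[OF b b_lim eventually_gt_at_top x_lim x_pos gx])
    \<comment> \<open>As (3 \<gamma>^3 \<xi>)^(1/3) = 3^(1/3) \<gamma> \<xi>^(1/3), dividing by
      3^(1/3) leaves \<gamma> K \<xi>^(1/3). Its limit is the nonzero constant found in
      \<open>V\<close>, so the ratio tends to 1 once \<xi>^(1/3) is cancelled.\<close>
    have "((\<lambda>\<gamma>. K_fs (3 * (\<gamma> ^ 3 * (\<xi>\<^sub>0 * \<epsilon> \<gamma>))) * (3 * (\<gamma> ^ 3 * (\<xi>\<^sub>0 * \<epsilon> \<gamma>))) powr (1/3) / 3 powr (1/3))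
        \<longlongrightarrow> 4 powr (1/3) / 3 powr (1/3)) at_top"
      by (intro tendsto_divide filterlim_compose[OF K_fs_asymptotics gx3] tendsto_const) simp
    moreover have "eventually (\<lambda>\<gamma>. K_fs (3 * (\<gamma> ^ 3 * (\<xi>\<^sub>0 * \<epsilon> \<gamma>))) * (3 * (\<gamma> ^ 3 * (\<xi>\<^sub>0 * \<epsilon> \<gamma>))) powr (1/3) / 3 powr (1/3)
        = \<gamma> * K_fs (3 * \<gamma> ^ 3 * (\<xi>\<^sub>0 * \<epsilon> \<gamma>)) * (\<xi>\<^sub>0 * \<epsilon> \<gamma>) powr (1/3)) at_top"
      using x_pos ev1
    proof eventually_elim
      case (elim \<gamma>)
      have "(\<gamma> ^ 3) powr (1/3) = \<gamma>"
        using elim by (simp add: powr_powr flip: powr_numeral)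
      then have "(3 * (\<gamma> ^ 3 * (\<xi>\<^sub>0 * \<epsilon> \<gamma>))) powr (1/3) = 3 powr (1/3) * (\<gamma> * (\<xi>\<^sub>0 * \<epsilon> \<gamma>) powr (1/3))"
        using elim by (metis powr_mult)
      then show ?case by (simp add: mult.assoc)
    qed
    ultimately have K: "((\<lambda>\<gamma>. \<gamma> * K_fs (3 * \<gamma> ^ 3 * (\<xi>\<^sub>0 * \<epsilon> \<gamma>)) * (\<xi>\<^sub>0 * \<epsilon> \<gamma>) powr (1/3))
        \<longlongrightarrow> (4/3) powr (1/3)) at_top"
      by (auto simp: powr_divide intro: Lim_transform_eventually)
    show "(\<lambda>\<gamma>. potential (\<beta> \<gamma>) (\<xi>\<^sub>0 * \<epsilon> \<gamma>)) \<sim>[at_top] (\<lambda>\<gamma>. \<gamma> * K_fs (3 * \<gamma> ^ 3 * (\<xi>\<^sub>0 * \<epsilon> \<gamma>)))"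
    proof (rule asymp_equivI', rule Lim_transform_eventually)
      show "((\<lambda>\<gamma>. (potential (\<beta> \<gamma>) (\<xi>\<^sub>0 * \<epsilon> \<gamma>) * (\<xi>\<^sub>0 * \<epsilon> \<gamma>) powr (1/3)) /
          (\<gamma> * K_fs (3 * \<gamma> ^ 3 * (\<xi>\<^sub>0 * \<epsilon> \<gamma>)) * (\<xi>\<^sub>0 * \<epsilon> \<gamma>) powr (1/3))) \<longlongrightarrow> 1) at_top"
        using tendsto_divide[OF V K] by simp
      show "eventually (\<lambda>\<gamma>. (potential (\<beta> \<gamma>) (\<xi>\<^sub>0 * \<epsilon> \<gamma>) * (\<xi>\<^sub>0 * \<epsilon> \<gamma>) powr (1/3)) /
          (\<gamma> * K_fs (3 * \<gamma> ^ 3 * (\<xi>\<^sub>0 * \<epsilon> \<gamma>)) * (\<xi>\<^sub>0 * \<epsilon> \<gamma>) powr (1/3)) =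
          potential (\<beta> \<gamma>) (\<xi>\<^sub>0 * \<epsilon> \<gamma>) / (\<gamma> * K_fs (3 * \<gamma> ^ 3 * (\<xi>\<^sub>0 * \<epsilon> \<gamma>)))) at_top"
        using x_pos by eventually_elim (intro mult_divide_mult_cancel_right, force)
    qed
  next
    assume neg: "\<xi>\<^sub>0 < 0" and large: "(\<lambda>\<gamma>. \<gamma> powi (-2)) \<in> o[at_top](\<epsilon>)"
    \<comment> \<open>Because \<gamma>^(-2) = 1 - \<beta>^2, the extra growth condition on
      \<epsilon> says exactly that (1 - \<beta>^2)/\<xi> vanishes in the limit.\<close>
    have "((\<lambda>\<gamma>. \<gamma> powi (-2) / \<epsilon> \<gamma> / \<xi>\<^sub>0) \<longlongrightarrow> 0 / \<xi>\<^sub>0) at_top"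
      by (intro tendsto_divide smalloD_tendsto[OF large] tendsto_const \<xi>\<^sub>0)
    moreover have "eventually (\<lambda>\<gamma>. \<gamma> powi (-2) / \<epsilon> \<gamma> / \<xi>\<^sub>0 = (1 - (\<beta> \<gamma>)\<^sup>2) / (\<xi>\<^sub>0 * \<epsilon> \<gamma>)) at_top"
      using b by eventually_elim (simp add: power_int_minus divide_inverse mult_ac)
    ultimately have bx: "((\<lambda>\<gamma>. (1 - (\<beta> \<gamma>)\<^sup>2) / (\<xi>\<^sub>0 * \<epsilon> \<gamma>)) \<longlongrightarrow> 0) at_top"
      by (auto intro: Lim_transform_eventually)
    have x_neg: "eventually (\<lambda>\<gamma>. \<xi>\<^sub>0 * \<epsilon> \<gamma> < 0) at_top"
      using ev1 by eventually_elim (use neg \<epsilon>_pos mult_neg_pos in blast)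
    show "((\<lambda>\<gamma>. potential (\<beta> \<gamma>) (\<xi>\<^sub>0 * \<epsilon> \<gamma>)) \<longlongrightarrow> 0) at_top"
      by (rule potential_tendsto_0_neg[OF _ b_lim x_lim x_neg bx]) (use b in eventually_elim, simp)
  qed
qed

end
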